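(* A $T_0$-space $X$ has a compactification which is a strong Eberlein compact iff $X$ is an SE-space.
   Context: "Space" means topological $T_0$-space. A compactification of $X$ is a compact Hausdorff space containing a dense subspace homeomorphic to $X$. A strong Eberlein compact is a compact space that can be embedded, for some set $\Gamma$, in $\sigma(\mathbb D,\Gamma)=\{x\in\mathbb D^\Gamma: |\{\gamma\in\Gamma: x(\gamma)=1\}|<\aleph_0\}$, where $\mathbb D=\{0,1\}$ is discrete and $\mathbb D^\Gamma$ has the product topology; equivalently, a compact Hausdorff space having a point-finite family $\gamma$ of clopen sets which is $T_0$-separating (for all $x\neq y$ there is $U\in\gamma$ with $|U\cap\{x,y\}|=1$). A family of subsets of a set is strongly point-finite if every subfamily of cardinality $\aleph_0$ contains a finite subfamily with empty intersection. A space $X$ is an SE-space if it has a strongly point-finite family $\alpha$ of clopen subsets such that $\alpha\cup\{X\setminus V: V\in\alpha\}$ is a subbase of $X$. *)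

theory Defs
  imports "HOL-Analysis.Analysis"
begin

definition compactification :: "'b topology \<Rightarrow> 'a topology \<Rightarrow> bool" where
  "compactification K X \<longleftrightarrow> compact_space K \<and> Hausdorff_space K \<and>
     (\<exists>S. S \<subseteq> topspace K \<and> K closure_of S = topspace K \<and> X homeomorphic_space subtopology K S)"

text \<open>The two-point discrete space is the discrete space \<open>bool\<close>, with \<open>True\<close> in the role of 1.\<close>

definition sigma_space :: "'i set \<Rightarrow> ('i \<Rightarrow> bool) topology" where
  "sigma_space \<Gamma> = subtopology (product_topology (\<lambda>_. discrete_topology UNIV) \<Gamma>)
     {x. finite {\<gamma> \<in> \<Gamma>. x \<gamma>}}"

text \<open>An existential quantifier cannot range over types, so the index set is taken among the sets
  of subsets of the underlying type of \<open>K\<close>. By \<open>strong_eberlein_compactI\<close> below this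
  is no restriction: an embedding with an index set of any type whatsoever suffices.\<close>

definition strong_eberlein_compact :: "'b topology \<Rightarrow> bool" where
  "strong_eberlein_compact K \<longleftrightarrow> compact_space K \<and>
     (\<exists>(\<Gamma> :: 'b set set) f. embedding_map K (sigma_space \<Gamma>) f)"

lemma Hausdorff_sigma_space: "Hausdorff_space (sigma_space \<Gamma>)"
  unfolding sigma_space_def
  by (intro Hausdorff_space_subtopology) (simp add: Hausdorff_space_product_topology)

lemma strong_eberlein_compactI:
  fixes K :: "'b topology" and \<Gamma> :: "'i set"
  assumes K: "compact_space K" and f: "embedding_map K (sigma_space \<Gamma>) f"
  shows "strong_eberlein_compact K"
proof -
  define U where "U = (\<lambda>\<gamma>. {x \<in> topspace K. f x \<gamma>})"
  define g where "g = (\<lambda>x. restrict (\<lambda>V. x \<in> V) (U ` \<Gamma>))"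
  have cf: "continuous_map K (sigma_space \<Gamma>) f" and injf: "inj_on f (topspace K)"
    using f by (auto simp: embedding_map_def homeomorphic_eq_everything_map
        continuous_map_in_subtopology)
  have cfc: "continuous_map K (discrete_topology UNIV) (\<lambda>x. f x \<gamma>)" if "\<gamma> \<in> \<Gamma>" for \<gamma>
    using cf that by (auto simp: sigma_space_def continuous_map_in_subtopology
        continuous_map_componentwise)
  have ext: "f x \<in> extensional \<Gamma>" and fin: "finite {\<gamma> \<in> \<Gamma>. f x \<gamma>}" if "x \<in> topspace K" for x
    using continuous_map_image_subset_topspace[OF cf] that
    by (auto simp: sigma_space_def PiE_def)
  have "continuous_map K (discrete_topology UNIV) (\<lambda>x. g x V)" if "V \<in> U ` \<Gamma>" for V
  proof -
    from that obtain \<gamma> where \<gamma>: "\<gamma> \<in> \<Gamma>" "V = U \<gamma>" by blast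
    show ?thesis
      by (rule continuous_map_eq[OF cfc[OF \<gamma>(1)]]) (use \<gamma> in \<open>auto simp: g_def U_def\<close>)
  qed
  moreover have "finite {V \<in> U ` \<Gamma>. g x V}" if "x \<in> topspace K" for x
    by (rule finite_subset[OF _ finite_imageI[OF fin[OF that], of U]]) (auto simp: g_def U_def)
  ultimately have cg: "continuous_map K (sigma_space (U ` \<Gamma>)) g"
    by (auto simp: sigma_space_def continuous_map_in_subtopology continuous_map_componentwise
        g_def)
  have "inj_on g (topspace K)"
  proof (rule inj_onI)
    fix x y assume x: "x \<in> topspace K" and y: "y \<in> topspace K" and eq: "g x = g y"
    have "f x \<gamma> = f y \<gamma>" if "\<gamma> \<in> \<Gamma>" for \<gamma>
      using fun_cong[OF eq, of "U \<gamma>"] that x y by (auto simp: g_def U_def)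
    then have "f x = f y"
      using ext[OF x] ext[OF y] by (intro extensionalityI)
    then show "x = y"
      using injf x y by (auto dest: inj_onD)
  qed
  then have "embedding_map K (sigma_space (U ` \<Gamma>)) g"
    using continuous_imp_embedding_map[OF cg K Hausdorff_sigma_space] by blast
  then show ?thesis
    using K by (auto simp: strong_eberlein_compact_def)
qed

text \<open>Since \<open>\<Inter>{} = UNIV\<close>, the family \<open>\<F>\<close> is necessarily nonempty.\<close>

definition strongly_point_finite :: "'a set set \<Rightarrow> bool" where
  "strongly_point_finite \<A> \<longleftrightarrow>
     (\<forall>\<B>. \<B> \<subseteq> \<A> \<and> countable \<B> \<and> infinite \<B> \<longrightarrow> (\<exists>\<F>. \<F> \<subseteq> \<B> \<and> finite \<F> \<and> \<Inter>\<F> = {}))"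

text \<open>The intersection of the empty subfamily of a subbase is the whole space.\<close>

definition subbase_of :: "'a topology \<Rightarrow> 'a set set \<Rightarrow> bool" where
  "subbase_of X \<S> \<longleftrightarrow> \<S> \<subseteq> Collect (openin X) \<and>
     X = topology (arbitrary union_of (finite intersection_of (\<lambda>U. U \<in> \<S>) relative_to topspace X))"

definition se_space :: "'a topology \<Rightarrow> bool" where
  "se_space X \<longleftrightarrow> (\<exists>\<A>. (\<forall>V\<in>\<A>. openin X V \<and> closedin X V) \<and> strongly_point_finite \<A> \<and>
     subbase_of X (\<A> \<union> {topspace X - V |V. V \<in> \<A>}))"

end

theory Submission
  imports Defs
begin

text \<open>A family \<open>\<A>\<close> of clopen sets forms, together with the complements, a subbase of a T0-space \<open>X\<close> iff
  membership in the sets of \<open>\<A>\<close> embeds \<open>X\<close> in a Cantor cube \<open>{0,1}\<^sup>\<A>\<close>. Let \<open>K\<close> be the closure of the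
  image. A finite subfamily of \<open>\<A>\<close> has a common point in \<open>X\<close> iff the corresponding clopen sets of the
  cube have a common point in \<open>K\<close>. Hence, by compactness, \<open>\<A>\<close> is strongly point-finite iff all points
  of \<open>K\<close> have finite support.\<close>

section \<open>Cantor cubes and the neighbourhood form of subbases\<close>

abbreviation cantor_cube :: "'i set \<Rightarrow> ('i \<Rightarrow> bool) topology" where
  "cantor_cube \<Gamma> \<equiv> product_topology (\<lambda>_. discrete_topology UNIV) \<Gamma>"

text \<open>Finite intersections of open subbase members, cut down to the carrier, are open, so the
  generated topology is \<open>X\<close> as soon as every open set is a union of such intersections.
  Cutting down matters only for the empty \<open>\<F>\<close>, where \<open>\<Inter>\<F>\<close> is
  the whole type.\<close>

lemma subbase_of_iff:
  "subbase_of X \<S> \<longleftrightarrow> \<S> \<subseteq> Collect (openin X) \<and>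
     (\<forall>U x. openin X U \<and> x \<in> U \<longrightarrow>
        (\<exists>\<F>. finite \<F> \<and> \<F> \<subseteq> \<S> \<and> x \<in> \<Inter>\<F> \<and> topspace X \<inter> \<Inter>\<F> \<subseteq> U))"
proof -
  define P where "P = (finite intersection_of (\<lambda>U. U \<in> \<S>) relative_to topspace X)"
  have P: "P T \<longleftrightarrow> (\<exists>\<F>. finite \<F> \<and> \<F> \<subseteq> \<S> \<and> T = topspace X \<inter> \<Inter>\<F>)" for T
    unfolding P_def relative_to_def intersection_of_def by blast
  have "openin (topology (arbitrary union_of P)) = (arbitrary union_of P)"
    unfolding P_def using istopology_subbase by (rule topology_inverse')
  then have "X = topology (arbitrary union_of P) \<longleftrightarrow> (\<forall>U. openin X U \<longleftrightarrow> (arbitrary union_of P) U)"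
    by (metis topology_eq)
  also have "\<dots> \<longleftrightarrow> (\<forall>U x. openin X U \<and> x \<in> U \<longrightarrow> (\<exists>T. P T \<and> x \<in> T \<and> T \<subseteq> U))"
    if S: "\<S> \<subseteq> Collect (openin X)"
  proof -
    have PX: "openin X T" if "P T" for T
    proof -
      obtain \<F> where F: "finite \<F>" "\<F> \<subseteq> \<S>" "T = topspace X \<inter> \<Inter>\<F>"
        using \<open>P T\<close> unfolding P by blast
      show ?thesis
      proof (cases "\<F> = {}")
        case True
        with F show ?thesis by simp
      next
        case False
        then have "openin X (\<Inter>\<F>)"
          using F S by (intro openin_Inter) auto
        then show ?thesis
          using F by blast
      qed
    qed
    have iff: "(arbitrary union_of P) U \<longleftrightarrow> (\<forall>x\<in>U. \<exists>T. P T \<and> x \<in> T \<and> T \<subseteq> U)" for U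
      by (simp add: arbitrary_union_of_alt)
    have "openin X U" if "\<forall>x\<in>U. \<exists>T. P T \<and> x \<in> T \<and> T \<subseteq> U" for U
      using that PX by (subst openin_subopen) blast
    then show ?thesis
      unfolding iff by blast
  qed
  finally have eq: "\<S> \<subseteq> Collect (openin X) \<Longrightarrow> X = topology (arbitrary union_of P) \<longleftrightarrow>
    (\<forall>U x. openin X U \<and> x \<in> U \<longrightarrow> (\<exists>T. P T \<and> x \<in> T \<and> T \<subseteq> U))" .
  have "(\<exists>T. P T \<and> x \<in> T \<and> T \<subseteq> U) \<longleftrightarrow>
      (\<exists>\<F>. finite \<F> \<and> \<F> \<subseteq> \<S> \<and> x \<in> \<Inter>\<F> \<and> topspace X \<inter> \<Inter>\<F> \<subseteq> U)"
    if "openin X U" "x \<in> U" for U x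
    unfolding P using openin_subset[OF that(1)] that(2) by blast
  with eq show ?thesis
    unfolding subbase_of_def P_def[symmetric] by (smt (verit, best))
qed

section \<open>Embeddings in Cantor cubes versus clopen subbases\<close>

lemma embedding_imp_continuous_map: "embedding_map X Y f \<Longrightarrow> continuous_map X Y f"
  by (auto simp: embedding_map_def homeomorphic_eq_everything_map continuous_map_in_subtopology)

lemma openin_cantor_cube_box:
  assumes "finite {\<gamma> \<in> \<Gamma>. P \<gamma>}"
  shows "openin (cantor_cube \<Gamma>) (Pi\<^sub>E \<Gamma> (\<lambda>\<gamma>. if P \<gamma> then B \<gamma> else UNIV))"
proof -
  have "finite {\<gamma> \<in> \<Gamma>. (if P \<gamma> then B \<gamma> else UNIV) \<noteq> UNIV}"
    by (rule finite_subset[OF _ assms]) auto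
  then show ?thesis
    by (simp add: openin_PiE_gen)
qed

lemma clopen_coordinate:
  assumes g: "continuous_map X (cantor_cube \<Gamma>) g" and "\<gamma> \<in> \<Gamma>"
  shows "openin X {x \<in> topspace X. g x \<gamma>}" and "closedin X {x \<in> topspace X. g x \<gamma>}"
proof -
  have c: "continuous_map X (discrete_topology UNIV) (\<lambda>x. g x \<gamma>)"
    using assms by (simp add: continuous_map_componentwise)
  show "openin X {x \<in> topspace X. g x \<gamma>}"
    using openin_continuous_map_preimage[OF c, of "{True}"] by simp
  show "closedin X {x \<in> topspace X. g x \<gamma>}"
    using closedin_continuous_map_preimage[OF c, of "{True}"] by simp
qed

text \<open>A basic box around \<open>g x\<close> restricts only finitely many coordinates. Fixing
  each of these at its value at \<open>x\<close> keeps a point in the box, and fixing a coordinate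
  means lying in some \<open>V \<gamma>\<close> or in its complement.\<close>

lemma subbase_of_embedding_cantor_cube:
  assumes g: "embedding_map X (cantor_cube \<Gamma>) g"
  defines "V \<equiv> \<lambda>\<gamma>. {x \<in> topspace X. g x \<gamma>}"
  shows "subbase_of X (V ` \<Gamma> \<union> {topspace X - W |W. W \<in> V ` \<Gamma>})"
  unfolding subbase_of_iff
proof (intro conjI allI impI)
  have cg: "continuous_map X (cantor_cube \<Gamma>) g"
    using g by (rule embedding_imp_continuous_map)
  show "V ` \<Gamma> \<union> {topspace X - W |W. W \<in> V ` \<Gamma>} \<subseteq> Collect (openin X)"
    using clopen_coordinate[OF cg] unfolding V_def by blast
  fix U x assume "openin X U \<and> x \<in> U"
  then have U: "openin X U" "x \<in> U" by auto
  have inj: "inj_on g (topspace X)"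
    using g by (simp add: embedding_map_def homeomorphic_eq_everything_map)
  have "openin (subtopology (cantor_cube \<Gamma>) (g ` topspace X)) (g ` U)"
    using g U(1) unfolding embedding_map_def by (meson homeomorphic_imp_open_map open_map_def)
  then obtain T where T: "openin (cantor_cube \<Gamma>) T" "g ` U = T \<inter> g ` topspace X"
    by (auto simp: openin_subtopology)
  have Ux: "U \<subseteq> topspace X"
    using U(1) by (rule openin_subset)
  have "g x \<in> T"
    using T(2) U(2) by blast
  then obtain W where W: "finite {\<gamma> \<in> \<Gamma>. W \<gamma> \<noteq> UNIV}" "g x \<in> Pi\<^sub>E \<Gamma> W" "Pi\<^sub>E \<Gamma> W \<subseteq> T"
    using T(1) unfolding openin_product_topology_alt topspace_discrete_topology by blast
  define c where "c = (\<lambda>\<gamma>. if g x \<gamma> then V \<gamma> else topspace X - V \<gamma>)"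
  define \<F> where "\<F> = c ` {\<gamma> \<in> \<Gamma>. W \<gamma> \<noteq> UNIV}"
  have "y \<in> U" if y: "y \<in> topspace X \<inter> \<Inter>\<F>" for y
  proof -
    have "g y \<gamma> \<in> W \<gamma>" if "\<gamma> \<in> \<Gamma>" for \<gamma>
    proof (cases "W \<gamma> = UNIV")
      case False
      then have "y \<in> c \<gamma>"
        using y that by (auto simp: \<F>_def)
      then have "g y \<gamma> = g x \<gamma>"
        using y by (auto simp: c_def V_def split: if_splits)
      then show ?thesis
        using W(2) that by (auto simp: PiE_iff)
    qed simp
    \<comment> \<open>Membership in a \<open>Pi\<^sub>E\<close> box also prescribes the values
      outside \<open>\<Gamma>\<close>.\<close>
    moreover have "g y \<in> extensional \<Gamma>"
      using continuous_map_image_subset_topspace[OF cg] y by (auto simp: PiE_iff)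
    ultimately have "g y \<in> T"
      using W(3) by (simp add: PiE_iff subset_iff)
    then have "g y \<in> g ` U"
      using T(2) y by blast
    then show ?thesis
      using inj y Ux by (auto dest: inj_onD)
  qed
  moreover have "x \<in> \<Inter>\<F>"
    using U(2) Ux by (auto simp: \<F>_def c_def V_def)
  moreover have "finite \<F>" "\<F> \<subseteq> V ` \<Gamma> \<union> {topspace X - W |W. W \<in> V ` \<Gamma>}"
    using W(1) by (auto simp: \<F>_def c_def)
  ultimately show "\<exists>\<F>. finite \<F> \<and> \<F> \<subseteq> V ` \<Gamma> \<union> {topspace X - W |W. W \<in> V ` \<Gamma>} \<and>
      x \<in> \<Inter>\<F> \<and> topspace X \<inter> \<Inter>\<F> \<subseteq> U"
    by blast
qed

text \<open>The subbase property makes every open set of \<open>X\<close> the preimage, near each of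
  its points, of an open set of the cube. This gives openness onto the image and, with the T0 axiom,
  injectivity; continuity holds because the sets in \<open>\<A>\<close> are clopen.\<close>

lemma embedding_cantor_cube_of_subbase:
  fixes X :: "'a topology"
  assumes t0: "t0_space X" and clopen: "\<forall>V\<in>\<A>. openin X V \<and> closedin X V"
    and sub: "subbase_of X (\<A> \<union> {topspace X - V |V. V \<in> \<A>})"
  defines "e \<equiv> \<lambda>x. restrict (\<lambda>V. x \<in> V) \<A>"
  shows "embedding_map X (cantor_cube \<A>) e"
proof -
  let ?Y = "subtopology (cantor_cube \<A>) (e ` topspace X)"
  have basic: "\<exists>T. openin (cantor_cube \<A>) T \<and> e x \<in> T \<and> (\<forall>y\<in>topspace X. e y \<in> T \<longrightarrow> y \<in> U)"
    if U: "openin X U" "x \<in> U" for U x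
  proof -
    obtain \<F> where F: "finite \<F>" "\<F> \<subseteq> \<A> \<union> {topspace X - V |V. V \<in> \<A>}"
        "x \<in> \<Inter>\<F>" "topspace X \<inter> \<Inter>\<F> \<subseteq> U"
      using sub U unfolding subbase_of_iff by meson
    have x: "x \<in> topspace X"
      using U openin_subset by blast
    define T where "T = Pi\<^sub>E \<A> (\<lambda>V. if V \<in> \<F> \<or> topspace X - V \<in> \<F> then {x \<in> V} else UNIV)"
    \<comment> \<open>Complementing twice gives back \<open>V\<close>, so the finite family
      \<open>\<F>\<close> involves only finitely many \<open>V\<close>, and the box \<open>T\<close>
      is open.\<close>
    have "V \<in> \<F> \<union> (\<lambda>W. topspace X - W) ` \<F>"
      if "V \<in> \<A>" "V \<in> \<F> \<or> topspace X - V \<in> \<F>" for V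
    proof -
      have "V = topspace X - (topspace X - V)"
        using clopen that(1) openin_subset by blast
      then show ?thesis
        using that(2) by blast
    qed
    then have "{V \<in> \<A>. V \<in> \<F> \<or> topspace X - V \<in> \<F>} \<subseteq> \<F> \<union> (\<lambda>W. topspace X - W) ` \<F>"
      by blast
    then have "finite {V \<in> \<A>. V \<in> \<F> \<or> topspace X - V \<in> \<F>}"
      by (rule finite_subset) (use F(1) in simp)
    then have "openin (cantor_cube \<A>) T"
      unfolding T_def by (rule openin_cantor_cube_box)
    moreover have "e x \<in> T"
      by (auto simp: T_def e_def)
    moreover have "y \<in> U" if y: "y \<in> topspace X" "e y \<in> T" for y
    proof -
      have mem: "y \<in> V \<longleftrightarrow> x \<in> V" if "V \<in> \<A>" "V \<in> \<F> \<or> topspace X - V \<in> \<F>" for V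
        using y(2) that by (auto simp: T_def e_def PiE_iff split: if_splits)
      have "y \<in> W" if "W \<in> \<F>" for W
      proof -
        consider "W \<in> \<A>" | V where "V \<in> \<A>" "W = topspace X - V"
          using F(2) \<open>W \<in> \<F>\<close> by blast
        then show ?thesis
        proof cases
          case 1
          then show ?thesis using mem[of W] F(3) \<open>W \<in> \<F>\<close> by blast
        next
          case 2
          then show ?thesis using mem[of V] F(3) \<open>W \<in> \<F>\<close> y(1) by blast
        qed
      qed
      then show ?thesis
        using F(4) y(1) by blast
    qed
    ultimately show ?thesis by blast
  qed
  have cont: "continuous_map X (cantor_cube \<A>) e"
    unfolding continuous_map_componentwise
  proof (intro conjI ballI)
    fix V assume V: "V \<in> \<A>"
    \<comment> \<open>Depending on which truth values lie in \<open>B\<close>, this preimage is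
      empty, \<open>V\<close>, its complement or the whole space.\<close>
    have "openin X {x \<in> topspace X. (x \<in> V) \<in> B}" for B
    proof -
      have "(x \<in> V) \<in> B \<longleftrightarrow> (if x \<in> V then True \<in> B else False \<in> B)" for x
        by simp
      moreover have "V \<subseteq> topspace X"
        using clopen V openin_subset by blast
      ultimately have "{x \<in> topspace X. (x \<in> V) \<in> B} =
          (if True \<in> B then V else {}) \<union> (if False \<in> B then topspace X - V else {})"
        by (auto split: if_splits)
      then show ?thesis
        using clopen V by (simp add: openin_diff openin_Un)
    qed
    then show "continuous_map X (discrete_topology UNIV) (\<lambda>x. e x V)"
      using V by (simp add: continuous_map_def e_def)
  qed (auto simp: e_def)
  have "open_map X ?Y e"
    unfolding open_map_def
  proof (intro allI impI)
    fix U assume U: "openin X U"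
    have "\<exists>T. openin ?Y T \<and> p \<in> T \<and> T \<subseteq> e ` U" if "p \<in> e ` U" for p
    proof -
      obtain x where x: "x \<in> U" "p = e x"
        using \<open>p \<in> e ` U\<close> by blast
      obtain T where T: "openin (cantor_cube \<A>) T" "e x \<in> T" "\<forall>y\<in>topspace X. e y \<in> T \<longrightarrow> y \<in> U"
        using basic[OF U x(1)] by blast
      have "openin ?Y (T \<inter> e ` topspace X)"
        using T(1) by (auto simp: openin_subtopology)
      moreover have "p \<in> T \<inter> e ` topspace X" "T \<inter> e ` topspace X \<subseteq> e ` U"
        using T x openin_subset[OF U] by auto
      ultimately show ?thesis by blast
    qed
    then show "openin ?Y (e ` U)"
      by (subst openin_subopen) blast
  qed
  moreover have "inj_on e (topspace X)"
  proof (rule inj_onI, rule ccontr)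
    fix x y assume xy: "x \<in> topspace X" "y \<in> topspace X" "e x = e y" "x \<noteq> y"
    then obtain U where "openin X U" "x \<notin> U \<longleftrightarrow> y \<in> U"
      using t0 unfolding t0_space_def by blast
    then show False
      \<comment> \<open>Whichever point lies in \<open>U\<close>, \<open>basic\<close> at that point
        yields an open set containing the common image, which forces the other point into
        \<open>U\<close> as well.\<close>
      using basic[of U x] basic[of U y] xy by metis
  qed
  moreover have "e ` topspace X = topspace ?Y"
    using continuous_map_image_subset_topspace[OF cont] by (auto simp: topspace_subtopology)
  moreover have "continuous_map X ?Y e"
    using cont by (simp add: continuous_map_into_subtopology image_subset_iff_funcset[symmetric])
  ultimately show ?thesis
    unfolding embedding_map_def by (intro bijective_open_imp_homeomorphic_map)
qed

section \<open>Passing between compactifications and SE-spaces\<close>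

text \<open>The required family consists of the traces on \<open>X\<close> of the coordinate sets of
  \<open>K\<close>. Compactness turns an infinite subfamily without empty finite intersections into
  a point of \<open>K\<close> with infinite support.\<close>

lemma se_space_if_compactification:
  fixes K :: "'b topology"
  assumes cK: "compactification K X" and sK: "strong_eberlein_compact K"
  shows "se_space X"
proof -
  have K: "compact_space K"
    using cK by (simp add: compactification_def)
  obtain \<Gamma> :: "'b set set" and f where f: "embedding_map K (sigma_space \<Gamma>) f"
    using sK unfolding strong_eberlein_compact_def by blast
  obtain S h where S: "S \<subseteq> topspace K" and h: "homeomorphic_map X (subtopology K S) h"
    using cK by (auto simp: compactification_def homeomorphic_space)
  have hK: "embedding_map X K h"
    using h homeomorphic_imp_surjective_map[OF h] S by (simp add: embedding_map_def inf_absorb2)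
  have fc: "embedding_map K (cantor_cube \<Gamma>) f"
    using f by (simp add: sigma_space_def embedding_map_in_subtopology)
  have cf: "continuous_map K (cantor_cube \<Gamma>) f"
    using fc by (rule embedding_imp_continuous_map)
  have fin: "finite {\<gamma> \<in> \<Gamma>. f k \<gamma>}" if "k \<in> topspace K" for k
    using embedding_imp_continuous_map[OF f] that
    by (auto simp: sigma_space_def continuous_map_in_subtopology)
  have hX: "h x \<in> topspace K" if "x \<in> topspace X" for x
    using embedding_imp_continuous_map[OF hK] that by (auto simp: continuous_map_def)
  have g: "embedding_map X (cantor_cube \<Gamma>) (f \<circ> h)"
    using hK fc by (rule embedding_map_compose)
  define V where "V = (\<lambda>\<gamma>. {x \<in> topspace X. (f \<circ> h) x \<gamma>})"
  have "strongly_point_finite (V ` \<Gamma>)"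
    unfolding strongly_point_finite_def
  proof (intro allI impI, rule ccontr)
    fix \<B> assume B: "\<B> \<subseteq> V ` \<Gamma> \<and> countable \<B> \<and> infinite \<B>"
      and no: "\<nexists>\<F>. \<F> \<subseteq> \<B> \<and> finite \<F> \<and> \<Inter>\<F> = {}"
    \<comment> \<open>Distinct indices may give the same set, so the argument moves to an index set
      \<open>\<Delta>\<close>, which is infinite because its image is.\<close>
    from B obtain \<Delta> where D: "\<Delta> \<subseteq> \<Gamma>" "\<B> = V ` \<Delta>"
      by (meson subset_imageE)
    then have infD: "infinite \<Delta>"
      using B by blast
    define W where "W = (\<lambda>\<gamma>. {k \<in> topspace K. f k \<gamma>})"
    \<comment> \<open>The closed sets \<open>W \<gamma>\<close> have the finite intersection
      property: a common point \<open>x\<close> of finitely many \<open>V \<gamma>\<close> is sent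
      by \<open>h\<close> to a common point of the corresponding \<open>W \<gamma>\<close>.\<close>
    have "\<Inter>(W ` \<Delta>) \<noteq> {}"
    proof (rule K[unfolded compact_space_fip, rule_format], intro conjI ballI allI impI)
      show "closedin K C" if "C \<in> W ` \<Delta>" for C
        using that D(1) clopen_coordinate(2)[OF cf] by (auto simp: W_def)
      show "\<Inter>\<G> \<noteq> {}" if G: "finite \<G> \<and> \<G> \<subseteq> W ` \<Delta>" for \<G>
      proof -
        obtain \<Phi> where Phi: "finite \<Phi>" "\<Phi> \<subseteq> \<Delta>" "\<G> = W ` \<Phi>"
          using G by (meson finite_subset_image)
        then have "finite (V ` \<Phi>)" "V ` \<Phi> \<subseteq> \<B>"
          using D(2) by auto
        then have "\<Inter>(V ` \<Phi>) \<noteq> {}"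
          using no by blast
        then obtain x where "\<forall>\<gamma>\<in>\<Phi>. x \<in> V \<gamma>"
          by blast
        then have "h x \<in> \<Inter>(W ` \<Phi>)"
          using hX by (auto simp: V_def W_def)
        then show ?thesis
          unfolding Phi(3) by blast
      qed
    qed
    then obtain k where "\<forall>\<gamma>\<in>\<Delta>. k \<in> W \<gamma>"
      by blast
    then have "k \<in> topspace K" "\<Delta> \<subseteq> {\<gamma> \<in> \<Gamma>. f k \<gamma>}"
      using infD D(1) by (auto simp: W_def dest: infinite_imp_nonempty)
    then show False
      using fin infD finite_subset by blast
  qed
  then show ?thesis
    unfolding se_space_def
    using subbase_of_embedding_cantor_cube[OF g] clopen_coordinate[OF embedding_imp_continuous_map[OF g]]
    unfolding V_def by (intro exI[of _ "V ` \<Gamma>"]) (auto simp: V_def)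
qed

text \<open>\<open>K\<close> is the closure of the copy of \<open>X\<close> in the cube over
  \<open>\<A>\<close>. Strong point-finiteness is what keeps the limit points added by the closure
  inside \<open>sigma_space \<A>\<close>.\<close>

lemma compactification_if_se_space:
  fixes X :: "'a topology"
  assumes t0: "t0_space X" and se: "se_space X"
  shows "\<exists>K :: ('a set \<Rightarrow> bool) topology. compactification K X \<and> strong_eberlein_compact K"
proof -
  obtain \<A> where clopen: "\<forall>V\<in>\<A>. openin X V \<and> closedin X V"
    and spf: "strongly_point_finite \<A>"
    and sub: "subbase_of X (\<A> \<union> {topspace X - V |V. V \<in> \<A>})"
    using se by (auto simp: se_space_def)
  define e where "e = (\<lambda>x. restrict (\<lambda>V. x \<in> V) \<A>)"
  have e: "embedding_map X (cantor_cube \<A>) e"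
    unfolding e_def using t0 clopen sub by (rule embedding_cantor_cube_of_subbase)
  let ?C = "cantor_cube \<A>"
  let ?S = "e ` topspace X"
  define K where "K = subtopology ?C (?C closure_of ?S)"
  have eC: "?S \<subseteq> topspace ?C"
    using embedding_imp_continuous_map[OF e] by (rule continuous_map_image_subset_topspace)
  have topK: "topspace K = ?C closure_of ?S"
    unfolding K_def topspace_subtopology by (intro Int_absorb1 closure_of_subset_topspace)
  have SK: "?S \<subseteq> topspace K"
    unfolding topK using eC by (rule closure_of_subset)
  have "compact_space ?C"
    by (simp add: compact_space_product_topology compact_space_discrete_topology)
  then have K: "compact_space K"
    unfolding K_def by (simp add: closedin_compact_space compact_space_subtopology)
  have H: "Hausdorff_space K"
    unfolding K_def by (intro Hausdorff_space_subtopology) (simp add: Hausdorff_space_product_topology)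
  have "X homeomorphic_space subtopology K ?S"
    using e SK by (auto simp: K_def embedding_map_def homeomorphic_space subtopology_subtopology topK inf_absorb2)
  moreover have "K closure_of ?S = topspace K"
    using SK unfolding topK by (simp add: K_def closure_of_subtopology inf_absorb2)
  ultimately have comp: "compactification K X"
    using K H SK by (auto simp: compactification_def)
  have fin: "finite {V \<in> \<A>. p V}" if p: "p \<in> topspace K" for p
  proof (rule ccontr)
    assume "infinite {V \<in> \<A>. p V}"
    then obtain \<B> where B: "\<B> \<subseteq> {V \<in> \<A>. p V}" "countable \<B>" "infinite \<B>"
      using infinite_countable_subset' by blast
    then obtain \<F> where F: "\<F> \<subseteq> \<B>" "finite \<F>" "\<Inter>\<F> = {}"
      using spf unfolding strongly_point_finite_def by (metis (no_types, lifting) mem_Collect_eq subset_iff)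
    \<comment> \<open>\<open>T\<close> is a neighbourhood of \<open>p\<close> since \<open>p\<close>
      is \<open>True\<close> on \<open>\<F>\<close>. It therefore meets the image of
      \<open>X\<close>, and a point \<open>x\<close> with \<open>e x\<close> in \<open>T\<close>
      lies in every member of \<open>\<F>\<close>.\<close>
    define T where "T = Pi\<^sub>E \<A> (\<lambda>V. if V \<in> \<F> then {True} else UNIV)"
    have "openin ?C T"
      unfolding T_def using F(2) by (intro openin_cantor_cube_box) simp
    moreover have "p \<in> T"
      using p B F unfolding topK T_def by (auto simp: in_closure_of PiE_iff)
    ultimately obtain x where "x \<in> topspace X" "e x \<in> T"
      using p unfolding topK in_closure_of by blast
    then have "x \<in> \<Inter>\<F>"
      using F(1) B(1) by (force simp: T_def e_def PiE_iff split: if_splits)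
    then show False
      using F(3) by blast
  qed
  have "continuous_map K (sigma_space \<A>) id"
    unfolding sigma_space_def continuous_map_in_subtopology
  proof
    show "continuous_map K ?C id"
      unfolding K_def by (intro continuous_map_from_subtopology continuous_map_id)
    show "id \<in> topspace K \<rightarrow> {x. finite {\<gamma> \<in> \<A>. x \<gamma>}}"
      using fin by simp
  qed
  then have "embedding_map K (sigma_space \<A>) id"
    using K Hausdorff_sigma_space by (rule continuous_imp_embedding_map) simp
  \<comment> \<open>The index set \<open>\<A>\<close> consists of subsets of the type of
    \<open>X\<close>, not of \<open>K\<close>; \<open>strong_eberlein_compactI\<close> permits this
    change of index type.\<close>
  with K have "strong_eberlein_compact K"
    by (rule strong_eberlein_compactI)
  with comp show ?thesis by blast
qed

(* The compactification K ranges over all topological spaces. As HOL cannot quantify over types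
   inside a formula, the equivalence is stated for K on the type 'a set => bool, which only makes
   the existence of K more specific, and the implication from the existence of K is stated for K
   on an arbitrary type 'b as well. *)
theorem theorem3p12:
  fixes X :: "'a topology"
  assumes "t0_space X"
  shows "((\<exists>K :: ('a set \<Rightarrow> bool) topology. compactification K X \<and> strong_eberlein_compact K)
            \<longleftrightarrow> se_space X) \<and>
         ((\<exists>K :: 'b topology. compactification K X \<and> strong_eberlein_compact K)
            \<longrightarrow> se_space X)"
proof (intro conjI iffI impI)
  show "\<exists>K :: ('a set \<Rightarrow> bool) topology. compactification K X \<and> strong_eberlein_compact K" if "se_space X"
    using assms that by (rule compactification_if_se_space)
\<comment> \<open>The remaining goals are the two implications to \<open>se_space X\<close>, which
  differ only in the type underlying \<open>K\<close>.\<close>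
qed (elim exE conjE, erule (1) se_space_if_compactification)+

end
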